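(* Assume that the problem $\min_{\theta\in\mathbb{R}^d}F(\theta)=\frac1m\sum_{i=1}^mf_i(\theta)$ has a solution. Suppose that a distributed algorithm generates (random) sequences $\{x_i^k\}\subseteq\mathbb{R}^d$, $i\in[m]$, such that almost surely, for any optimal solution $\theta^*$, $$\begin{bmatrix}\mathbb{E}[\|\bar x^{k+1}-\theta^*\|^2\mid\mathcal{F}^k]\\ \mathbb{E}[\sum_{i=1}^m\|x_i^{k+1}-\bar x^{k+1}\|^2\mid\mathcal{F}^k]\end{bmatrix}\le\left(\begin{bmatrix}1&\frac{\gamma^k}{m}\\0&1-\kappa\gamma^k\end{bmatrix}+a^k\mathbf{1}\mathbf{1}^T\right)\begin{bmatrix}\|\bar x^k-\theta^*\|^2\\ \sum_{i=1}^m\|x_i^k-\bar x^k\|^2\end{bmatrix}+b^k\mathbf{1}-c^k\begin{bmatrix}F(\bar x^k)-F(\theta^* )\\0\end{bmatrix},\quad\forall k\ge0,$$ where $\bar x^k=\frac1m\sum_{i=1}^mx_i^k$, $\mathcal{F}^k=\{x_i^\ell,\ i\in[m],\ 0\le\ell\le k\}$, the random nonnegative scalar sequences $\{a^k\},\{b^k\}$ satisfy $\sum_{k=0}^\infty a^k<\infty$ and $\sum_{k=0}^\infty b^k<\infty$ almost surely, the deterministic nonnegative sequences $\{c^k\}$ and $\{\gamma^k\}$ satisfy $\sum_{k=0}^\infty c^k=\infty$ and $\sum_{k=0}^\infty\gamma^k=\infty$, and the scalar $\kappa>0$ satisfies $\kappa\gamma^k<1$ for all $k\ge0$. Then $\lim_{k\to\infty}\|x_i^k-\bar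 x^k\|=0$ almost surely for all $i$, and there is a solution $\tilde\theta^*$ such that $\lim_{k\to\infty}\|\bar x^k-\tilde\theta^*\|=0$ almost surely.
   Context: $[m]=\{1,\dots,m\}$; vector inequalities are entrywise; $\mathbf{1}\in\mathbb{R}^2$ is the all-ones vector. $\mathbb{E}[\cdot\mid\mathcal{F}^k]$ is conditional expectation given $\mathcal{F}^k$. The solution $\tilde\theta^*$ may be random. Standing assumption on the objective functions: $F$ is convex, and each $f_i:\mathbb{R}^d\to\mathbb{R}$ is differentiable with Lipschitz continuous gradient, i.e. for some $L>0$, $\|\nabla f_i(u)-\nabla f_i(v)\|\le L\|u-v\|$ for all $i\in[m]$, $u,v\in\mathbb{R}^d$. *)

theory Defs
  imports "HOL-Probability.Probability"
begin

definition average :: "nat \<Rightarrow> (nat \<Rightarrow> 'a::real_vector) \<Rightarrow> 'a" where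
  "average m y = (1 / real m) *\<^sub>R (\<Sum>i\<in>{1..m}. y i)"

definition objective :: "nat \<Rightarrow> (nat \<Rightarrow> 'a \<Rightarrow> real) \<Rightarrow> 'a \<Rightarrow> real" where
  "objective m f \<theta> = average m (\<lambda>i. f i \<theta>)"

definition solutions :: "('a \<Rightarrow> real) \<Rightarrow> 'a set" where
  "solutions F = {\<theta>. is_arg_min F (\<lambda>_. True) \<theta>}"

text \<open>An algorithm's iterates are given as \<open>x i k \<omega>\<close>: agent \<open>i\<close>, iteration \<open>k\<close>, outcome \<open>\<omega>\<close>.\<close>

definition mean_iterate ::
    "nat \<Rightarrow> (nat \<Rightarrow> nat \<Rightarrow> 'w \<Rightarrow> 'a::real_vector) \<Rightarrow> nat \<Rightarrow> 'w \<Rightarrow> 'a" where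
  "mean_iterate m x k \<omega> = average m (\<lambda>i. x i k \<omega>)"

definition consensus_error ::
    "nat \<Rightarrow> (nat \<Rightarrow> nat \<Rightarrow> 'w \<Rightarrow> 'a::real_normed_vector) \<Rightarrow> nat \<Rightarrow> 'w \<Rightarrow> real" where
  "consensus_error m x k \<omega> = (\<Sum>i\<in>{1..m}. (norm (x i k \<omega> - mean_iterate m x k \<omega>))\<^sup>2)"

definition history ::
    "'w measure \<Rightarrow> nat \<Rightarrow> (nat \<Rightarrow> nat \<Rightarrow> 'w \<Rightarrow> 'a::topological_space) \<Rightarrow> nat \<Rightarrow> 'w measure" where
  "history M m x k =
     sigma (space M) {x i l -` B \<inter> space M | i l B. i \<in> {1..m} \<and> l \<le> k \<and> B \<in> sets borel}"

text \<open>
  Conditional expectation of a nonnegative random variable, with no integrability requirement, so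
  the value may be \<open>\<infinity>\<close> (\<open>real_cond_exp\<close> would silently turn such values into \<open>0\<close>).  It is read in
  \<open>ereal\<close> rather than \<open>ennreal\<close> so that it can be compared with real bounds that are not known to
  be nonnegative; coercing these to \<open>ennreal\<close> would truncate them at \<open>0\<close>.
\<close>

definition nonneg_cond_exp ::
    "'w measure \<Rightarrow> 'w measure \<Rightarrow> ('w \<Rightarrow> real) \<Rightarrow> 'w \<Rightarrow> ereal" where
  "nonneg_cond_exp M G X \<omega> = enn2ereal (nn_cond_exp M G (\<lambda>w. ennreal (X w)) \<omega>)"

end

theory Submission
  imports Defs
begin

text \<open>
  The row vector \<open>(1, 1 / (m \<kappa>))\<close> is fixed by the unperturbed recursion matrix, so the corresponding
  combination \<open>V\<close> of the two errors is an almost supermartingale in the sense of Robbins and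
  Siegmund.  Hence \<open>V\<close> converges and \<open>\<Sum>k. c k * (F (xbar k) - F \<theta>)\<close> is finite almost surely.  Since
  \<open>V\<close> is bounded, the consensus error alone is again an almost supermartingale; now
  \<open>\<Sum>k. \<gamma> k * consensus_error k\<close> is finite, which forces its limit to be 0.  So the distances from
  \<open>xbar k\<close> to each point of a countable dense set of solutions converge, and as \<open>F (xbar k)\<close> comes
  arbitrarily close to the minimum, some cluster point of \<open>xbar k\<close> is a solution and therefore its limit.

  The perturbations \<open>a k\<close> and \<open>b k\<close> are not assumed adapted.  This is harmless: only the ratio
  between the conditional expectation of the next value and the present value matters, and
  that ratio is adapted.
\<close>

section \<open>Convergence of nonnegative supermartingales\<close>

text \<open>This is the state, once \<open>X n\<close> is seen, of the strategy in Doob's upcrossing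
  argument: enter below \<open>a\<close>, leave on reaching \<open>b\<close> or more. Defining it by
  recursion instead of hitting times makes adaptedness a plain induction. \<open>upcrossings\<close>
  counts the exits.\<close>

primrec holding :: "real \<Rightarrow> real \<Rightarrow> (nat \<Rightarrow> real) \<Rightarrow> nat \<Rightarrow> bool" where
  "holding a b X 0 \<longleftrightarrow> X 0 < a"
| "holding a b X (Suc n) \<longleftrightarrow> (if holding a b X n then X (Suc n) < b else X (Suc n) < a)"

primrec upcrossings :: "real \<Rightarrow> real \<Rightarrow> (nat \<Rightarrow> real) \<Rightarrow> nat \<Rightarrow> nat" where
  "upcrossings a b X 0 = 0"
| "upcrossings a b X (Suc n) =
    upcrossings a b X n + (if holding a b X n \<and> \<not> holding a b X (Suc n) then 1 else 0)"

lemma mono_upcrossings: "mono (upcrossings a b X)"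
  by (rule incseq_SucI) simp

text \<open>A bounded monotone count is eventually constant, and from then on a holding phase can no
  longer end. But a late value below \<open>a\<close> ensures that one is under way, and a still
  later value above \<open>b\<close> would end it.\<close>

lemma no_oscillation_if_bounded_upcrossings:
  assumes "a < b" and bdd: "\<And>n. upcrossings a b X n \<le> K"
  shows "\<not> ((\<exists>\<^sub>F n in sequentially. X n < a) \<and> (\<exists>\<^sub>F n in sequentially. b < X n))"
proof
  assume osc: "(\<exists>\<^sub>F n in sequentially. X n < a) \<and> (\<exists>\<^sub>F n in sequentially. b < X n)"
  obtain n0 where n0: "\<And>n. upcrossings a b X n \<le> upcrossings a b X n0"
    using ex_has_greatest_nat[of "\<lambda>_. True" 0 "upcrossings a b X" "Suc K"] bdd
    by (auto simp: less_Suc_eq_le)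
  have const: "upcrossings a b X n = upcrossings a b X n0" if "n \<ge> n0" for n
    using monoD[OF mono_upcrossings that] n0 by (intro antisym)
  have stay: "holding a b X (Suc n)" if "n \<ge> n0" "holding a b X n" for n
    using const[of "Suc n"] const[of n] that by (auto split: if_splits)
  obtain n1 where n1: "n1 \<ge> Suc n0" "X n1 < a"
    using osc by (auto simp: frequently_sequentially)
  then have hold1: "holding a b X n1"
    using \<open>a < b\<close> by (cases n1) auto
  have hold: "holding a b X n" if "n \<ge> n1" for n
    using that
  proof (induction n rule: dec_induct)
    case base
    show ?case by (rule hold1)
  next
    case (step n)
    with n1(1) show ?case by (intro stay) auto
  qed
  obtain n2 where n2: "n2 \<ge> Suc n1" "b < X n2"
    using osc by (auto simp: frequently_sequentially)
  then obtain k where "n2 = Suc k" "k \<ge> n1"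
    by (cases n2) auto
  with hold[of n2] hold[of k] n2 show False
    by auto
qed

text \<open>If the lower limit were less than the upper limit, two rationals would fit strictly
  between them and the sequence would oscillate across both. The premise \<open>fin\<close> excludes
  divergence to infinity.\<close>

lemma convergent_if_no_oscillation:
  fixes X :: "nat \<Rightarrow> real"
  assumes nonneg: "\<And>n. 0 \<le> X n"
    and fin: "\<exists>\<^sub>F n in sequentially. X n \<le> C"
    and osc: "\<And>p q :: rat. p < q \<Longrightarrow>
      \<not> ((\<exists>\<^sub>F n in sequentially. X n < of_rat p) \<and> (\<exists>\<^sub>F n in sequentially. of_rat q < X n))"
  shows "convergent X"
proof -
  let ?Y = "\<lambda>n. ereal (X n)"
  have "limsup ?Y \<le> liminf ?Y"
  proof (rule ccontr)
    assume "\<not> limsup ?Y \<le> liminf ?Y"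
    then obtain p where p: "liminf ?Y < ereal (of_rat p)" "ereal (of_rat p) < limsup ?Y"
      using ereal_dense3[of "liminf ?Y" "limsup ?Y"] unfolding not_le by blast
    then obtain q where q: "ereal (of_rat p) < ereal (of_rat q)" "ereal (of_rat q) < limsup ?Y"
      using ereal_dense3[of "ereal (of_rat p)" "limsup ?Y"] by blast
    have "\<exists>\<^sub>F n in sequentially. X n < of_rat p"
      using Liminf_bounded[of "ereal (of_rat p)" ?Y sequentially] p(1)
      by (auto simp: frequently_def not_less)
    moreover have "\<exists>\<^sub>F n in sequentially. of_rat q < X n"
      using Limsup_bounded[of ?Y "ereal (of_rat q)" sequentially] q(2)
      by (auto simp: frequently_def not_less)
    ultimately show False
      using osc[of p q] q(1) by (auto simp: of_rat_less)
  qed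
  then have eq: "liminf ?Y = limsup ?Y"
    by (intro antisym Liminf_le_Limsup) auto
  have "0 \<le> liminf ?Y"
    using nonneg by (intro Liminf_bounded) auto
  then obtain l where l: "liminf ?Y = ereal l"
    using less_LiminfD[of "ereal C" sequentially ?Y] fin
    by (cases "liminf ?Y") (auto simp: frequently_def not_le)
  have "?Y \<longlonglongrightarrow> ereal l"
    using eq l by (intro Liminf_eq_Limsup) auto
  then show ?thesis
    by (auto simp: convergent_def)
qed

section \<open>Filtrations and the upcrossing inequality\<close>

locale filtered_prob_space = prob_space M for M :: "'w measure" +
  fixes \<F> :: "nat \<Rightarrow> 'w measure"
  assumes subalgebra: "\<And>k. subalgebra M (\<F> k)"
    and sets_mono: "\<And>k. sets (\<F> k) \<subseteq> sets (\<F> (Suc k))"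
begin

lemma space_filtration [simp]: "space (\<F> k) = space M"
  using subalgebra by (auto simp: subalgebra_def)

lemma measurable_filtration_Suc: "g \<in> measurable (\<F> k) N \<Longrightarrow> g \<in> measurable (\<F> (Suc k)) N"
  using sets_mono[of k] by (auto simp: measurable_def)

lemma measurable_filtration_le:
  assumes "g \<in> measurable (\<F> k) N" "k \<le> n"
  shows "g \<in> measurable (\<F> n) N"
  using assms(2,1) by (induction n rule: dec_induct) (auto intro: measurable_filtration_Suc)

lemma measurable_ambient: "g \<in> measurable (\<F> k) N \<Longrightarrow> g \<in> measurable M N"
  using measurable_from_subalg[OF subalgebra] .

lemma holding_measurable:
  assumes W: "\<And>k. W k \<in> borel_measurable (\<F> k)"
  shows "Measurable.pred (\<F> n) (\<lambda>\<omega>. holding a b (\<lambda>k. W k \<omega>) n)"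
proof (induction n)
  case 0
  show ?case using W[of 0] by simp
next
  case (Suc n)
  note [measurable] = measurable_filtration_Suc[OF Suc.IH] W[of "Suc n"]
  show ?case by simp
qed

lemma upcrossings_measurable:
  assumes W: "\<And>k. W k \<in> borel_measurable (\<F> k)"
  shows "(\<lambda>\<omega>. upcrossings a b (\<lambda>k. W k \<omega>) n) \<in> measurable (\<F> n) (count_space UNIV)"
proof (induction n)
  case 0
  show ?case by simp
next
  case (Suc n)
  note [measurable] = measurable_filtration_Suc[OF Suc.IH]
    holding_measurable[where n = "Suc n" and a = a and b = b, OF W]
    measurable_filtration_Suc[OF holding_measurable[where n = n and a = a and b = b, OF W]]
  show ?case by (simp del: holding.simps)
qed

text \<open>Doob's upcrossing inequality for nonnegative supermartingales. The bound depends neither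
  on \<open>n\<close> nor on \<open>W 0\<close>. The supermartingale property is stated through
  integrals over events, which makes sense even for infinite expectations.\<close>

lemma upcrossings_bound:
  fixes W :: "nat \<Rightarrow> 'w \<Rightarrow> real"
  assumes W: "\<And>k. W k \<in> borel_measurable (\<F> k)" and nonneg: "\<And>k \<omega>. 0 \<le> W k \<omega>"
    and super: "\<And>k A. A \<in> sets (\<F> k) \<Longrightarrow>
      (\<integral>\<^sup>+\<omega>\<in>A. ennreal (W (Suc k) \<omega>) \<partial>M) \<le> (\<integral>\<^sup>+\<omega>\<in>A. ennreal (W k \<omega>) \<partial>M)"
    and ab: "0 \<le> a" "a < b"
  shows "(\<integral>\<^sup>+\<omega>. ennreal ((b - a) * real (upcrossings a b (\<lambda>k. W k \<omega>) n)) \<partial>M) \<le> ennreal a"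
proof -
  define H where "H n \<omega> = holding a b (\<lambda>k. W k \<omega>) n" for n \<omega>
  define N where "N n \<omega> = (b - a) * real (upcrossings a b (\<lambda>k. W k \<omega>) n)" for n \<omega>
  \<comment> \<open>While holding, \<open>Z\<close> moves with \<open>W\<close>; starting or stopping to hold can only decrease it.  So \<open>Z\<close> is
    a nonnegative supermartingale that starts below \<open>a\<close>.\<close>
  define Z where "Z n \<omega> = N n \<omega> + (if H n \<omega> then W n \<omega> else a)" for n \<omega>
  have N_nonneg: "0 \<le> N n \<omega>" for n \<omega>
    using ab by (simp add: N_def)
  have HF: "Measurable.pred (\<F> n) (H n)" for n
    unfolding H_def by (rule holding_measurable[OF W])
  have [measurable]: "Measurable.pred M (H n)" for n
    using HF by (rule measurable_ambient)
  have [measurable]: "W n \<in> borel_measurable M" for n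
    using W by (rule measurable_ambient)
  have [measurable]: "(\<lambda>\<omega>. upcrossings a b (\<lambda>k. W k \<omega>) n) \<in> measurable M (count_space UNIV)" for n
    using upcrossings_measurable[OF W] by (rule measurable_ambient)
  have [measurable]: "N n \<in> borel_measurable M" for n
    unfolding N_def by measurable
  \<comment> \<open>When holding stops, \<open>N\<close> gains \<open>b - a\<close> and the position
    \<open>W\<close> is replaced by \<open>a\<close>. The sum of these two is \<open>b\<close>,
    which is at most the current \<open>W\<close>.\<close>
  have Z_step: "Z (Suc n) \<omega> \<le> N n \<omega> + (if H n \<omega> then W (Suc n) \<omega> else a)" for n \<omega>
    by (auto simp: Z_def N_def H_def algebra_simps)
  \<comment> \<open>Only the last summand depends on \<open>V\<close>, and it is an integral over an
    event of \<open>\<F> n\<close>, so the supermartingale inequality applies to it directly. The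
    common summand is never cancelled, so it may be infinite.\<close>
  have int_split: "(\<integral>\<^sup>+\<omega>. ennreal (N n \<omega> + (if H n \<omega> then V \<omega> else a)) \<partial>M) =
      (\<integral>\<^sup>+\<omega>. ennreal (N n \<omega>) + (if H n \<omega> then 0 else ennreal a) \<partial>M) +
      (\<integral>\<^sup>+\<omega>\<in>{\<omega>\<in>space M. H n \<omega>}. ennreal (V \<omega>) \<partial>M)"
    if [measurable]: "V \<in> borel_measurable M" and V: "\<And>\<omega>. 0 \<le> V \<omega>" for V n
  proof -
    have "ennreal (N n \<omega> + (if H n \<omega> then V \<omega> else a)) =
      ennreal (N n \<omega>) + (if H n \<omega> then 0 else ennreal a) +
      ennreal (V \<omega>) * indicator {\<omega>\<in>space M. H n \<omega>} \<omega>" if "\<omega> \<in> space M" for \<omega>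
      using N_nonneg V ab that by (auto simp: ennreal_plus)
    then have "(\<integral>\<^sup>+\<omega>. ennreal (N n \<omega> + (if H n \<omega> then V \<omega> else a)) \<partial>M) =
      (\<integral>\<^sup>+\<omega>. ennreal (N n \<omega>) + (if H n \<omega> then 0 else ennreal a) +
        ennreal (V \<omega>) * indicator {\<omega>\<in>space M. H n \<omega>} \<omega> \<partial>M)"
      by (intro nn_integral_cong)
    also have "\<dots> = (\<integral>\<^sup>+\<omega>. ennreal (N n \<omega>) + (if H n \<omega> then 0 else ennreal a) \<partial>M) +
      (\<integral>\<^sup>+\<omega>\<in>{\<omega>\<in>space M. H n \<omega>}. ennreal (V \<omega>) \<partial>M)"
      by (intro nn_integral_add) measurable
    finally show ?thesis .
  qed
  have "(\<integral>\<^sup>+\<omega>. ennreal (Z n \<omega>) \<partial>M) \<le> ennreal a"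
  proof (induction n)
    case 0
    have "(\<integral>\<^sup>+\<omega>. ennreal (Z 0 \<omega>) \<partial>M) \<le> (\<integral>\<^sup>+\<omega>. ennreal a \<partial>M)"
      by (intro nn_integral_mono ennreal_leI) (auto simp: Z_def N_def H_def)
    then show ?case
      by (simp add: emeasure_space_1)
  next
    case (Suc n)
    have "{\<omega>\<in>space M. H n \<omega>} \<in> sets (\<F> n)"
      using HF[of n] by (simp add: pred_def)
    note le = super[OF this]
    have "(\<integral>\<^sup>+\<omega>. ennreal (Z (Suc n) \<omega>) \<partial>M)
        \<le> (\<integral>\<^sup>+\<omega>. ennreal (N n \<omega> + (if H n \<omega> then W (Suc n) \<omega> else a)) \<partial>M)"
      by (intro nn_integral_mono ennreal_leI Z_step)
    also have "\<dots> \<le> (\<integral>\<^sup>+\<omega>. ennreal (N n \<omega> + (if H n \<omega> then W n \<omega> else a)) \<partial>M)"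
      using le nonneg by (simp add: int_split add_left_mono)
    also have "\<dots> \<le> ennreal a"
      using Suc.IH by (simp add: Z_def)
    finally show ?case .
  qed
  moreover have "N n \<omega> \<le> Z n \<omega>" for n \<omega>
    using nonneg ab by (simp add: Z_def)
  then have "(\<integral>\<^sup>+\<omega>. ennreal (N n \<omega>) \<partial>M) \<le> (\<integral>\<^sup>+\<omega>. ennreal (Z n \<omega>) \<partial>M)"
    by (intro nn_integral_mono ennreal_leI)
  ultimately show ?thesis
    unfolding N_def by (rule order_trans[rotated])
qed

text \<open>Doob's convergence theorem: the upcrossing inequality rules out oscillation across each
  pair of rationals, and Fatou's lemma rules out an infinite limit.\<close>

theorem nonneg_supermartingale_convergent:
  fixes W :: "nat \<Rightarrow> 'w \<Rightarrow> real"
  assumes W: "\<And>k. W k \<in> borel_measurable (\<F> k)" and nonneg: "\<And>k \<omega>. 0 \<le> W k \<omega>"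
    and super: "\<And>k A. A \<in> sets (\<F> k) \<Longrightarrow>
      (\<integral>\<^sup>+\<omega>\<in>A. ennreal (W (Suc k) \<omega>) \<partial>M) \<le> (\<integral>\<^sup>+\<omega>\<in>A. ennreal (W k \<omega>) \<partial>M)"
  shows "AE \<omega> in M. convergent (\<lambda>k. W k \<omega>)"
proof -
  have WM [measurable]: "W k \<in> borel_measurable M" for k
    using W by (rule measurable_ambient)
  have osc: "AE \<omega> in M. \<not> ((\<exists>\<^sub>F n in sequentially. W n \<omega> < a) \<and> (\<exists>\<^sub>F n in sequentially. b < W n \<omega>))"
    if "a < b" for a b
  proof (cases "0 \<le> a")
    case False
    then have "\<not> (\<exists>\<^sub>F n in sequentially. W n \<omega> < a)" for \<omega>
      using order_trans[OF _ nonneg] by (force simp: frequently_def not_less)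
    then show ?thesis by simp
  next
    case True
    let ?u = "\<lambda>n \<omega>. ennreal ((b - a) * real (upcrossings a b (\<lambda>k. W k \<omega>) n))"
    have [measurable]: "(\<lambda>\<omega>. upcrossings a b (\<lambda>k. W k \<omega>) n) \<in> measurable M (count_space UNIV)" for n
      using upcrossings_measurable[OF W] by (rule measurable_ambient)
    \<comment> \<open>The bound \<open>a\<close> is uniform in \<open>n\<close>, so by monotone
      convergence the total number of upcrossings has finite expectation and is almost surely
      finite.\<close>
    have "(\<integral>\<^sup>+\<omega>. (SUP n. ?u n \<omega>) \<partial>M) = (SUP n. \<integral>\<^sup>+\<omega>. ?u n \<omega> \<partial>M)"
      using that monoD[OF mono_upcrossings]
      by (intro nn_integral_monotone_convergence_SUP)
        (auto simp: incseq_def le_fun_def intro!: ennreal_leI mult_left_mono)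
    also have "\<dots> \<le> ennreal a"
      by (intro SUP_least upcrossings_bound W nonneg super True that)
    finally have "(\<integral>\<^sup>+\<omega>. (SUP n. ?u n \<omega>) \<partial>M) \<noteq> \<infinity>"
      by (auto simp: top_unique)
    then have "AE \<omega> in M. (SUP n. ?u n \<omega>) \<noteq> \<infinity>"
      by (intro nn_integral_PInf_AE) auto
    then show ?thesis
    proof eventually_elim
      case (elim \<omega>)
      then obtain C where C: "(SUP n. ?u n \<omega>) = ennreal C" "0 \<le> C"
        by (cases "SUP n. ?u n \<omega>") auto
      have "upcrossings a b (\<lambda>k. W k \<omega>) n \<le> nat \<lfloor>C / (b - a)\<rfloor>" for n
      proof -
        have "?u n \<omega> \<le> ennreal C"
          using C by (metis SUP_upper UNIV_I)
        then have "(b - a) * real (upcrossings a b (\<lambda>k. W k \<omega>) n) \<le> C"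
          using C by (simp add: ennreal_le_iff)
        then show ?thesis
          using that by (simp add: le_nat_floor field_simps)
      qed
      from no_oscillation_if_bounded_upcrossings[OF that this] show ?case .
    qed
  qed
  \<comment> \<open>Since \<open>W 0\<close> may fail to be integrable, Fatou's lemma is applied on
    the events where \<open>W 0\<close> is at most \<open>K\<close>. These belong to every
    \<open>\<F> n\<close>, and they exhaust the space as \<open>K\<close> grows.\<close>
  have fin: "AE \<omega> in M. \<omega> \<in> {\<omega>\<in>space M. W 0 \<omega> \<le> real K} \<longrightarrow> liminf (\<lambda>n. ennreal (W n \<omega>)) \<noteq> \<infinity>" for K :: nat
  proof -
    define A where "A = {\<omega>\<in>space M. W 0 \<omega> \<le> real K}"
    have A0: "A \<in> sets (\<F> 0)"
      using borel_measurable_le[OF W[of 0] borel_measurable_const[of "real K"]] by (simp add: A_def)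
    have AF: "A \<in> sets (\<F> n)" for n
      using A0 sets_mono by (induction n) auto
    have [measurable]: "A \<in> sets M"
      unfolding A_def by measurable
    have bd: "(\<integral>\<^sup>+\<omega>\<in>A. ennreal (W n \<omega>) \<partial>M) \<le> ennreal (real K)" for n
    proof (induction n)
      case 0
      have "(\<integral>\<^sup>+\<omega>\<in>A. ennreal (W 0 \<omega>) \<partial>M) \<le> (\<integral>\<^sup>+\<omega>. ennreal (real K) \<partial>M)"
        by (intro nn_integral_mono) (auto simp: A_def indicator_def simp del: ennreal_of_nat_eq_real_of_nat intro!: ennreal_leI)
      then show ?case
        by (simp add: emeasure_space_1)
    next
      case (Suc n)
      with super[OF AF] show ?case
        by (rule order_trans)
    qed
    have "(\<integral>\<^sup>+\<omega>. liminf (\<lambda>n. ennreal (W n \<omega>) * indicator A \<omega>) \<partial>M)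
        \<le> liminf (\<lambda>n. \<integral>\<^sup>+\<omega>\<in>A. ennreal (W n \<omega>) \<partial>M)"
      by (intro nn_integral_liminf) measurable
    also have "\<dots> \<le> ennreal (real K)"
      by (rule order_trans[OF Liminf_le_Limsup Limsup_bounded]) (simp_all add: bd del: ennreal_of_nat_eq_real_of_nat)
    finally have "(\<integral>\<^sup>+\<omega>. liminf (\<lambda>n. ennreal (W n \<omega>) * indicator A \<omega>) \<partial>M) \<noteq> \<infinity>"
      by (auto simp: top_unique simp del: ennreal_of_nat_eq_real_of_nat)
    then have "AE \<omega> in M. liminf (\<lambda>n. ennreal (W n \<omega>) * indicator A \<omega>) \<noteq> \<infinity>"
      by (intro nn_integral_PInf_AE) auto
    then show ?thesis
      unfolding A_def[symmetric] by eventually_elim auto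
  qed
  have fin': "AE \<omega> in M. \<forall>K::nat. \<omega> \<in> {\<omega>\<in>space M. W 0 \<omega> \<le> real K} \<longrightarrow> liminf (\<lambda>n. ennreal (W n \<omega>)) \<noteq> \<infinity>"
    unfolding AE_all_countable using fin by blast
  have osc': "AE \<omega> in M. \<forall>p q :: rat. p < q \<longrightarrow>
      \<not> ((\<exists>\<^sub>F n in sequentially. W n \<omega> < of_rat p) \<and> (\<exists>\<^sub>F n in sequentially. of_rat q < W n \<omega>))"
    unfolding AE_all_countable
  proof (intro allI)
    fix p q :: rat
    show "AE \<omega> in M. p < q \<longrightarrow>
      \<not> ((\<exists>\<^sub>F n in sequentially. W n \<omega> < of_rat p) \<and> (\<exists>\<^sub>F n in sequentially. of_rat q < W n \<omega>))"
      using osc[of "of_rat p" "of_rat q"] by (cases "p < q") (simp_all add: of_rat_less)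
  qed
  from fin' osc' AE_space show ?thesis
  proof eventually_elim
    case (elim \<omega>)
    obtain K :: nat where "W 0 \<omega> \<le> real K"
      using real_arch_simple by blast
    with elim have "liminf (\<lambda>n. ennreal (W n \<omega>)) < \<infinity>"
      by (auto simp: less_top)
    then obtain C where C: "liminf (\<lambda>n. ennreal (W n \<omega>)) < ennreal C"
      using dense[of "liminf (\<lambda>n. ennreal (W n \<omega>))" \<infinity>] by (metis ennreal_cases infinity_ennreal_def less_irrefl)
    have "\<exists>\<^sub>F n in sequentially. W n \<omega> \<le> C"
      using Liminf_bounded[of "ennreal C" "\<lambda>n. ennreal (W n \<omega>)" sequentially] C
      by (auto simp: frequently_def not_le dest: eventually_mono[OF _ ennreal_leI[OF less_imp_le]])
    then show ?case
      using elim nonneg by (intro convergent_if_no_oscillation) auto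
  qed
qed

section \<open>The Robbins-Siegmund theorem\<close>

lemma sigma_finite_subalgebra: "sigma_finite_subalgebra M (\<F> k)"
  using subalgebra by (intro finite_measure_subalgebra_is_sigma_finite)
    (auto simp: finite_measure_subalgebra_def finite_measure_subalgebra_axioms_def finite_measure_axioms)

text \<open>The factor \<open>1 + V k\<close> lets the single sequence \<open>s\<close> carry both
  the multiplicative and the additive perturbation. Dividing \<open>1 + V\<close> by the product of
  its one-step growth ratios, and adding the rescaled sum of \<open>z\<close>, leaves a true
  supermartingale.\<close>

theorem almost_supermartingale_convergent:
  fixes V z s :: "nat \<Rightarrow> 'w \<Rightarrow> real"
  assumes V: "\<And>k. V k \<in> borel_measurable (\<F> k)" and V_nonneg: "\<And>k \<omega>. 0 \<le> V k \<omega>"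
    and z: "\<And>k. z k \<in> borel_measurable (\<F> k)" and z_nonneg: "\<And>k \<omega>. 0 \<le> z k \<omega>"
    and s_nonneg: "AE \<omega> in M. \<forall>k. 0 \<le> s k \<omega>" and s_summable: "AE \<omega> in M. summable (\<lambda>k. s k \<omega>)"
    and step: "AE \<omega> in M. \<forall>k. nn_cond_exp M (\<F> k) (\<lambda>w. ennreal (V (Suc k) w)) \<omega> + ennreal (z k \<omega>)
      \<le> ennreal (V k \<omega> + s k \<omega> * (1 + V k \<omega>))"
  shows "AE \<omega> in M. convergent (\<lambda>k. V k \<omega>) \<and> summable (\<lambda>k. z k \<omega>)"
proof -
  define Q where "Q k \<omega> = nn_cond_exp M (\<F> k) (\<lambda>w. ennreal (V (Suc k) w)) \<omega>" for k \<omega>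
  \<comment> \<open>The \<open>max 1\<close> makes the product \<open>P\<close> increasing and at
    least 1. \<open>enn2real\<close> sends an infinite value to 0, which does no harm because
    \<open>Q k\<close> is almost surely finite.\<close>
  define r where "r k \<omega> = max 1 ((1 + enn2real (Q k \<omega>) + z k \<omega>) / (1 + V k \<omega>))" for k \<omega>
  define P where "P n \<omega> = (\<Prod>k<n. r k \<omega>)" for n \<omega>
  define S where "S n \<omega> = (\<Sum>k<n. z k \<omega> / P (Suc k) \<omega>)" for n \<omega>
  \<comment> \<open>\<open>P\<close> is adapted, and it is bounded because \<open>r k \<le> 1 + s k\<close>, so \<open>W\<close> is a supermartingale whose
    convergence gives that of \<open>V\<close>.\<close>
  define W where "W n \<omega> = (1 + V n \<omega>) / P n \<omega> + S n \<omega>" for n \<omega>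
  have r1: "1 \<le> r k \<omega>" for k \<omega>
    by (simp add: r_def)
  have P_Suc: "P (Suc n) \<omega> = P n \<omega> * r n \<omega>" for n \<omega>
    by (simp add: P_def)
  have P1: "1 \<le> P n \<omega>" for n \<omega>
    unfolding P_def using r1 by (intro prod_ge_1) auto
  then have P0: "0 < P n \<omega>" for n \<omega>
    by (metis less_le_trans zero_less_one)
  have S_nonneg: "0 \<le> S n \<omega>" for n \<omega>
    unfolding S_def using z_nonneg P0 by (intro sum_nonneg divide_nonneg_pos) auto
  have W_nonneg: "0 \<le> W n \<omega>" for n \<omega>
    unfolding W_def using S_nonneg V_nonneg P0
    by (intro add_nonneg_nonneg divide_nonneg_pos) auto
  \<comment> \<open>The hypothesis first shows that \<open>Q k\<close> is finite; the inequality can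
    then be read in the reals, where \<open>z k\<close> may be subtracted.\<close>
  have Q_le: "Q k \<omega> \<le> ennreal (V k \<omega> + s k \<omega> * (1 + V k \<omega>) - z k \<omega>) \<and> z k \<omega> \<le> V k \<omega> + s k \<omega> * (1 + V k \<omega>)"
    if "Q k \<omega> + ennreal (z k \<omega>) \<le> ennreal (V k \<omega> + s k \<omega> * (1 + V k \<omega>))" "0 \<le> s k \<omega>" for k \<omega>
  proof -
    have nn: "0 \<le> V k \<omega> + s k \<omega> * (1 + V k \<omega>)"
      using that(2) V_nonneg by (simp add: add_nonneg_nonneg)
    have "Q k \<omega> < top"
      using that(1) by (metis ennreal_less_top le_less_trans add_increasing2 order_refl zero_le)
    then obtain q where q: "Q k \<omega> = ennreal q" "0 \<le> q"
      by (cases "Q k \<omega>") auto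
    with that(1) z_nonneg nn have "q + z k \<omega> \<le> V k \<omega> + s k \<omega> * (1 + V k \<omega>)"
      by (simp flip: ennreal_plus)
    then show ?thesis
      using q z_nonneg by (auto intro!: ennreal_leI)
  qed
  have Q_fin: "AE \<omega> in M. \<forall>k. Q k \<omega> < \<infinity>"
    using step s_nonneg
  proof eventually_elim
    case (elim \<omega>)
    then show ?case
      using Q_le[of _ \<omega>] unfolding Q_def[symmetric] by (metis ennreal_less_top infinity_ennreal_def le_less_trans)
  qed
  have QF [measurable]: "Q k \<in> borel_measurable (\<F> k)" for k
    unfolding Q_def by (rule borel_measurable_nn_cond_exp)
  have rF: "r k \<in> borel_measurable (\<F> k)" for k
  proof -
    note [measurable] = V[of k] z[of k]
    show ?thesis unfolding r_def by measurable
  qed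
  \<comment> \<open>The off-by-one matters: \<open>P (Suc k)\<close> involves only
    \<open>r 0\<close> to \<open>r k\<close>, so it is already known at time
    \<open>k\<close>.\<close>
  have PF: "P n \<in> borel_measurable (\<F> k)" if "n \<le> Suc k" for n k
    unfolding P_def using that by (intro borel_measurable_prod measurable_filtration_le[OF rF]) auto
  have SF: "S n \<in> borel_measurable (\<F> k)" if "n \<le> Suc k" for n k
    unfolding S_def using that
    by (intro borel_measurable_sum borel_measurable_divide measurable_filtration_le[OF z] PF) auto
  have WF: "W n \<in> borel_measurable (\<F> n)" for n
    unfolding W_def by (intro borel_measurable_add borel_measurable_divide borel_measurable_const V PF SF) auto
  have [measurable]: "V n \<in> borel_measurable M" "P n \<in> borel_measurable M" "S n \<in> borel_measurable M"
    "Q n \<in> borel_measurable M" for n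
    using measurable_ambient[OF V[of n]] measurable_ambient[OF PF[of n n]]
      measurable_ambient[OF SF[of n n]] measurable_ambient[OF QF[of n]] by auto
  have super: "(\<integral>\<^sup>+\<omega>\<in>A. ennreal (W (Suc k) \<omega>) \<partial>M) \<le> (\<integral>\<^sup>+\<omega>\<in>A. ennreal (W k \<omega>) \<partial>M)"
    if A: "A \<in> sets (\<F> k)" for k A
  proof -
    have [measurable]: "A \<in> sets M"
      using A subalgebra by (auto simp: subalgebra_def)
    \<comment> \<open>On \<open>A\<close>, \<open>W (Suc k)\<close> equals
      \<open>g * V (Suc k) + h\<close>. As \<open>g\<close> is measurable with respect to
      \<open>\<F> k\<close>, \<open>V (Suc k)\<close> may be replaced by \<open>Q k\<close> under
      the integral.\<close>
    define g where "g \<omega> = ennreal (1 / P (Suc k) \<omega>) * indicator A \<omega>" for \<omega>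
    define h where "h \<omega> = ennreal (1 / P (Suc k) \<omega> + S (Suc k) \<omega>) * indicator A \<omega>" for \<omega>
    note [measurable] = PF[of "Suc k" k] A
    have gF: "g \<in> borel_measurable (\<F> k)"
      unfolding g_def by measurable
    then have [measurable]: "g \<in> borel_measurable M"
      by (rule measurable_ambient)
    have [measurable]: "h \<in> borel_measurable M"
      unfolding h_def by measurable
    have "(\<integral>\<^sup>+\<omega>\<in>A. ennreal (W (Suc k) \<omega>) \<partial>M) = (\<integral>\<^sup>+\<omega>. g \<omega> * ennreal (V (Suc k) \<omega>) + h \<omega> \<partial>M)"
      using P0[of "Suc k"] V_nonneg S_nonneg
      by (intro nn_integral_cong)
        (auto simp: g_def h_def W_def indicator_def add_divide_distrib less_imp_le ac_simps
          simp flip: ennreal_plus ennreal_mult)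
    also have "\<dots> = (\<integral>\<^sup>+\<omega>. g \<omega> * ennreal (V (Suc k) \<omega>) \<partial>M) + (\<integral>\<^sup>+\<omega>. h \<omega> \<partial>M)"
      by (intro nn_integral_add) measurable
    also have "(\<integral>\<^sup>+\<omega>. g \<omega> * ennreal (V (Suc k) \<omega>) \<partial>M) = (\<integral>\<^sup>+\<omega>. g \<omega> * Q k \<omega> \<partial>M)"
      unfolding Q_def by (rule sigma_finite_subalgebra.nn_cond_exp_intg[OF sigma_finite_subalgebra gF, symmetric]) measurable
    also have "\<dots> + (\<integral>\<^sup>+\<omega>. h \<omega> \<partial>M) = (\<integral>\<^sup>+\<omega>. g \<omega> * Q k \<omega> + h \<omega> \<partial>M)"
      by (intro nn_integral_add[symmetric]) measurable
    also have "\<dots> \<le> (\<integral>\<^sup>+\<omega>\<in>A. ennreal (W k \<omega>) \<partial>M)"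
    proof (intro nn_integral_mono_AE)
      show "AE \<omega> in M. g \<omega> * Q k \<omega> + h \<omega> \<le> ennreal (W k \<omega>) * indicator A \<omega>"
        using Q_fin
      proof eventually_elim
        case (elim \<omega>)
        then obtain q where q: "Q k \<omega> = ennreal q" "0 \<le> q"
          by (cases "Q k \<omega>") (auto dest: spec[of _ k])
        have V1: "0 < 1 + V k \<omega>"
          using V_nonneg[of k \<omega>] by simp
        have "(1 + q + z k \<omega>) / (1 + V k \<omega>) \<le> r k \<omega>"
          using q by (simp add: r_def)
        then have "1 + q + z k \<omega> \<le> r k \<omega> * (1 + V k \<omega>)"
          using V1 by (simp add: pos_divide_le_eq)
        then have "(1 + q + z k \<omega>) / P (Suc k) \<omega> \<le> r k \<omega> * (1 + V k \<omega>) / P (Suc k) \<omega>"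
          using P0 by (intro divide_right_mono) (auto simp: less_imp_le)
        also have "\<dots> = (1 + V k \<omega>) / P k \<omega>"
          using r1[of k \<omega>] by (auto simp: P_Suc)
        finally have "q / P (Suc k) \<omega> + 1 / P (Suc k) \<omega> + S (Suc k) \<omega> \<le> W k \<omega>"
          by (simp add: W_def S_def add_divide_distrib)
        then show ?case
          using q P0[of "Suc k" \<omega>] S_nonneg[of "Suc k" \<omega>]
          by (auto simp: g_def h_def indicator_def less_imp_le ac_simps
              simp flip: ennreal_plus ennreal_mult intro!: ennreal_leI)
      qed
    qed
    finally show ?thesis .
  qed
  have "AE \<omega> in M. convergent (\<lambda>k. W k \<omega>)"
    by (rule nonneg_supermartingale_convergent[OF WF W_nonneg super])
  with step s_nonneg s_summable show ?thesis
  proof eventually_elim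
    case (elim \<omega>)
    \<comment> \<open>The bound comes from \<open>1 + s \<le> exp s\<close>, applied to each factor
      of \<open>P\<close>.\<close>
    let ?C = "exp (\<Sum>k. s k \<omega>)"
    have "r k \<omega> \<le> 1 + s k \<omega>" for k
    proof -
      let ?y = "V k \<omega> + s k \<omega> * (1 + V k \<omega>)"
      have "enn2real (Q k \<omega>) \<le> ?y - z k \<omega>"
        using Q_le[of k \<omega>] elim(1,2) unfolding Q_def[symmetric]
        by (intro enn2real_leI) auto
      then have "1 + enn2real (Q k \<omega>) + z k \<omega> \<le> (1 + s k \<omega>) * (1 + V k \<omega>)"
        by (simp add: algebra_simps)
      moreover have "0 < 1 + V k \<omega>"
        using V_nonneg[of k \<omega>] by simp
      ultimately show ?thesis
        using elim(2) by (simp add: r_def pos_divide_le_eq)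
    qed
    then have P_le: "P n \<omega> \<le> ?C" for n
    proof -
      have "P n \<omega> \<le> (\<Prod>k<n. exp (s k \<omega>))"
        unfolding P_def using r1 \<open>\<And>k. r k \<omega> \<le> 1 + s k \<omega>\<close>
        by (intro prod_mono) (meson exp_ge_add_one_self order_trans zero_le_one)
      also have "\<dots> = exp (\<Sum>k<n. s k \<omega>)"
        by (simp add: exp_sum)
      also have "\<dots> \<le> ?C"
        using elim by (auto intro!: sum_le_suminf)
      finally show ?thesis .
    qed
    have "incseq (\<lambda>n. P n \<omega>)"
      using r1 P0 by (intro incseq_SucI) (simp add: P_Suc less_imp_le)
    with P_le obtain p where p: "(\<lambda>n. P n \<omega>) \<longlonglongrightarrow> p"
      using incseq_convergent by blast
    obtain w where w: "(\<lambda>n. W n \<omega>) \<longlonglongrightarrow> w"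
      using elim by (auto simp: convergent_def)
    then have "Bseq (\<lambda>n. W n \<omega>)"
      by (intro convergent_imp_Bseq) (auto simp: convergent_def)
    then obtain K where K: "\<And>n. \<bar>W n \<omega>\<bar> \<le> K"
      by (auto simp: Bseq_def)
    \<comment> \<open>The difference \<open>W - S\<close> is nonnegative, so a bound on
      \<open>W\<close> also bounds the partial sums \<open>S\<close>.\<close>
    have S_le: "S n \<omega> \<le> K" for n
      using K[of n] V_nonneg[of n \<omega>] P0[of n \<omega>] unfolding W_def
      by (smt (verit) divide_nonneg_pos)
    then have summ: "summable (\<lambda>k. z k \<omega> / P (Suc k) \<omega>)"
      using z_nonneg P0 S_le unfolding S_def
      by (intro summableI_nonneg_bounded[where x = K] divide_nonneg_pos) auto
    have "convergent (\<lambda>n. S n \<omega>)"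
      using summ unfolding S_def summable_iff_convergent .
    then obtain t where t: "(\<lambda>n. S n \<omega>) \<longlonglongrightarrow> t"
      by (auto simp: convergent_def)
    \<comment> \<open>The definition of \<open>W\<close> is solved for \<open>V\<close>; the
      sequences \<open>W\<close>, \<open>S\<close> and \<open>P\<close> all converge.\<close>
    have "(\<lambda>n. (W n \<omega> - S n \<omega>) * P n \<omega> - 1) \<longlonglongrightarrow> (w - t) * p - 1"
      by (intro tendsto_intros w t p)
    moreover have "(W n \<omega> - S n \<omega>) * P n \<omega> - 1 = V n \<omega>" for n
      using P0[of n \<omega>] by (simp add: W_def)
    ultimately have "convergent (\<lambda>n. V n \<omega>)"
      by (auto simp: convergent_def)
    \<comment> \<open>Division by \<open>P\<close>, which is at most \<open>?C\<close>, shrinks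
      \<open>z\<close> by a bounded factor only, so summability carries back to
      \<open>z\<close>.\<close>
    moreover have "summable (\<lambda>k. z k \<omega>)"
    proof (rule summable_comparison_test'[where N=0])
      show "summable (\<lambda>k. ?C * (z k \<omega> / P (Suc k) \<omega>))"
        using summ by (rule summable_mult)
      show "norm (z k \<omega>) \<le> ?C * (z k \<omega> / P (Suc k) \<omega>)" for k
        using z_nonneg[of k \<omega>] P_le[of "Suc k"] P0[of "Suc k" \<omega>]
        by (simp add: field_simps mult_left_mono)
    qed
    ultimately show ?case by simp
  qed
qed

end

section \<open>The coupled recursion\<close>

lemma not_summable_if_suminf_ennreal_infinite:
  assumes "\<And>k. 0 \<le> c k" "(\<Sum>k. ennreal (c k)) = \<infinity>"
  shows "\<not> summable c"
  using suminf_ennreal2[of c] assms by auto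

text \<open>If \<open>z k\<close> were eventually at least \<open>\<epsilon>\<close>, then
  \<open>c k\<close> would be dominated by the summable \<open>c k * z k / \<epsilon>\<close>. This
  serves twice: for the consensus error with weights \<open>\<gamma>\<close> and for the objective
  gap with weights \<open>c\<close>.\<close>

lemma frequently_less_if_summable_weighted:
  fixes c z :: "nat \<Rightarrow> real"
  assumes c: "\<And>k. 0 \<le> c k" "\<not> summable c" and cz: "summable (\<lambda>k. c k * z k)" and "0 < \<epsilon>"
  shows "\<exists>\<^sub>F k in sequentially. z k < \<epsilon>"
proof (rule ccontr)
  assume "\<not> (\<exists>\<^sub>F k in sequentially. z k < \<epsilon>)"
  then have "\<forall>\<^sub>F k in sequentially. \<epsilon> \<le> z k"
    by (simp add: frequently_def not_less)
  then have "\<forall>\<^sub>F k in sequentially. norm (c k) \<le> c k * z k / \<epsilon>"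
  proof eventually_elim
    case (elim k)
    then show ?case
      using c(1)[of k] \<open>0 < \<epsilon>\<close> by (simp add: pos_le_divide_eq mult_left_mono)
  qed
  then have "summable c"
    using summable_divide[OF cz] by (rule summable_comparison_test_ev)
  with c(2) show False ..
qed

text \<open>Values in \<open>ennreal\<close> are nonnegative, hence so is any real upper bound. The
  second conclusion is recorded because \<open>ennreal\<close> truncates negative reals at 0, and
  such bounds are later added inside \<open>ennreal\<close>.\<close>

lemma enn2ereal_le_erealD:
  assumes "enn2ereal X \<le> ereal y"
  shows "X \<le> ennreal y \<and> 0 \<le> y"
  using assms by (cases X) (auto simp: enn2ereal_ennreal intro!: ennreal_leI)

context filtered_prob_space
begin

lemma nn_cond_exp_add_scaled:
  assumes g: "g \<in> borel_measurable M" "\<And>\<omega>. 0 \<le> g \<omega>"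
    and h: "h \<in> borel_measurable M" "\<And>\<omega>. 0 \<le> h \<omega>" and "0 \<le> p"
  shows "AE \<omega> in M. nn_cond_exp M (\<F> k) (\<lambda>w. ennreal (g w + p * h w)) \<omega> =
    nn_cond_exp M (\<F> k) (\<lambda>w. ennreal (g w)) \<omega> + ennreal p * nn_cond_exp M (\<F> k) (\<lambda>w. ennreal (h w)) \<omega>"
proof -
  note [measurable] = g(1) h(1)
  have "AE \<omega> in M. nn_cond_exp M (\<F> k) (\<lambda>w. ennreal (g w)) \<omega> +
      nn_cond_exp M (\<F> k) (\<lambda>w. ennreal p * ennreal (h w)) \<omega> =
      nn_cond_exp M (\<F> k) (\<lambda>w. ennreal (g w) + ennreal p * ennreal (h w)) \<omega>"
    by (rule sigma_finite_subalgebra.nn_cond_exp_sum[OF sigma_finite_subalgebra]) measurable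
  moreover have "AE \<omega> in M. ennreal p * nn_cond_exp M (\<F> k) (\<lambda>w. ennreal (h w)) \<omega> =
      nn_cond_exp M (\<F> k) (\<lambda>w. ennreal p * ennreal (h w)) \<omega>"
    by (rule sigma_finite_subalgebra.nn_cond_exp_prod[OF sigma_finite_subalgebra]) measurable
  moreover have "(\<lambda>w. ennreal (g w) + ennreal p * ennreal (h w)) = (\<lambda>w. ennreal (g w + p * h w))"
    using g h \<open>0 \<le> p\<close> by (simp add: ennreal_mult)
  ultimately show ?thesis
    by auto
qed

text \<open>Scalar form of the matrix recursion: \<open>u\<close> stands for the squared distance of
  the mean to a solution, \<open>e\<close> for the consensus error, \<open>d\<close> for the
  objective gap and \<open>\<mu>\<close> for the number of agents.\<close>

theorem coupled_recursion_convergent: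
  fixes u e d a b :: "nat \<Rightarrow> 'w \<Rightarrow> real" and c \<gamma> :: "nat \<Rightarrow> real" and \<mu> \<kappa> :: real
  assumes u: "\<And>k. u k \<in> borel_measurable (\<F> k)" "\<And>k \<omega>. 0 \<le> u k \<omega>"
    and e: "\<And>k. e k \<in> borel_measurable (\<F> k)" "\<And>k \<omega>. 0 \<le> e k \<omega>"
    and d: "\<And>k. d k \<in> borel_measurable (\<F> k)" "\<And>k \<omega>. 0 \<le> d k \<omega>"
    and a: "AE \<omega> in M. \<forall>k. 0 \<le> a k \<omega>" "AE \<omega> in M. summable (\<lambda>k. a k \<omega>)"
    and b: "AE \<omega> in M. \<forall>k. 0 \<le> b k \<omega>" "AE \<omega> in M. summable (\<lambda>k. b k \<omega>)"
    and c: "\<And>k. 0 \<le> c k" and \<gamma>: "\<And>k. 0 \<le> \<gamma> k" "\<not> summable \<gamma>"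
    and pos: "0 < \<mu>" "0 < \<kappa>"
    and u_step: "AE \<omega> in M. \<forall>k. enn2ereal (nn_cond_exp M (\<F> k) (\<lambda>w. ennreal (u (Suc k) w)) \<omega>)
      \<le> ereal (u k \<omega> + \<gamma> k / \<mu> * e k \<omega> + a k \<omega> * (u k \<omega> + e k \<omega>) + b k \<omega> - c k * d k \<omega>)"
    and e_step: "AE \<omega> in M. \<forall>k. enn2ereal (nn_cond_exp M (\<F> k) (\<lambda>w. ennreal (e (Suc k) w)) \<omega>)
      \<le> ereal ((1 - \<kappa> * \<gamma> k) * e k \<omega> + a k \<omega> * (u k \<omega> + e k \<omega>) + b k \<omega>)"
  shows "AE \<omega> in M. convergent (\<lambda>k. u k \<omega>) \<and> (\<lambda>k. e k \<omega>) \<longlonglongrightarrow> 0 \<and> summable (\<lambda>k. c k * d k \<omega>)"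
proof -
  \<comment> \<open>\<open>(1, p)\<close> is a left eigenvector, for the eigenvalue 1, of the unperturbed recursion matrix.\<close>
  define p where "p = 1 / (\<mu> * \<kappa>)"
  \<comment> \<open>This is \<open>1 + 1 / p\<close>. It is at least 1 and at least
    \<open>1 / p\<close>, so \<open>C * V\<close> dominates \<open>u + e\<close>.\<close>
  define C where "C = 1 + \<mu> * \<kappa>"
  define V where "V k \<omega> = u k \<omega> + p * e k \<omega>" for k \<omega>
  have p: "0 < p" and p\<gamma>: "p * (\<kappa> * y) = y / \<mu>" and C: "0 < C" for y
    using pos by (auto simp: p_def C_def add_pos_pos)
  have V_nonneg: "0 \<le> V k \<omega>" for k \<omega>
    using u e p by (simp add: V_def)
  have ue_le: "u k \<omega> + e k \<omega> \<le> C * V k \<omega>" for k \<omega>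
  proof -
    have "C * V k \<omega> = u k \<omega> + e k \<omega> + (\<mu> * \<kappa> * u k \<omega> + p * e k \<omega>)"
      using pos by (simp add: C_def V_def p_def field_simps)
    moreover have "0 \<le> \<mu> * \<kappa> * u k \<omega> + p * e k \<omega>"
      using u e p pos by (intro add_nonneg_nonneg mult_nonneg_nonneg) (auto simp: less_imp_le)
    ultimately show ?thesis by linarith
  qed
  have uM: "u k \<in> borel_measurable M" and eM: "e k \<in> borel_measurable M" for k
    using measurable_ambient[OF u(1)] measurable_ambient[OF e(1)] by auto
  have step_V: "AE \<omega> in M. \<forall>k. nn_cond_exp M (\<F> k) (\<lambda>w. ennreal (V (Suc k) w)) \<omega> =
      nn_cond_exp M (\<F> k) (\<lambda>w. ennreal (u (Suc k) w)) \<omega> +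
      ennreal p * nn_cond_exp M (\<F> k) (\<lambda>w. ennreal (e (Suc k) w)) \<omega>"
    unfolding AE_all_countable V_def using uM eM u e p
    by (intro allI nn_cond_exp_add_scaled) auto
  \<comment> \<open>The factor \<open>1 + p\<close> arises from adding \<open>p\<close> times the
    second row to the first, as both rows carry the same perturbation; \<open>C\<close> arises from
    bounding \<open>u + e\<close> by \<open>C * V\<close>.\<close>
  define s where "s k \<omega> = (1 + p) * (C * a k \<omega> + b k \<omega>)" for k \<omega>
  have V_conv: "AE \<omega> in M. convergent (\<lambda>k. V k \<omega>) \<and> summable (\<lambda>k. c k * d k \<omega>)"
  proof (rule almost_supermartingale_convergent[where s = s])
    show "V k \<in> borel_measurable (\<F> k)" for k
      unfolding V_def using u e by (intro borel_measurable_add borel_measurable_times borel_measurable_const)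
    show "(\<lambda>\<omega>. c k * d k \<omega>) \<in> borel_measurable (\<F> k)" for k
      using d by (intro borel_measurable_times borel_measurable_const)
    show "0 \<le> c k * d k \<omega>" for k \<omega>
      using c d by simp
    show "AE \<omega> in M. \<forall>k. 0 \<le> s k \<omega>"
      using a(1) b(1) by eventually_elim (use p C in \<open>auto simp: s_def\<close>)
    show "AE \<omega> in M. summable (\<lambda>k. s k \<omega>)"
      using a(2) b(2) unfolding s_def
      by eventually_elim (intro summable_mult summable_add)
    show "AE \<omega> in M. \<forall>k. nn_cond_exp M (\<F> k) (\<lambda>w. ennreal (V (Suc k) w)) \<omega> + ennreal (c k * d k \<omega>)
        \<le> ennreal (V k \<omega> + s k \<omega> * (1 + V k \<omega>))"
      using u_step e_step step_V a(1) b(1)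
    proof eventually_elim
      case (elim \<omega>)
      show ?case
      proof
        fix k
        let ?y1 = "u k \<omega> + \<gamma> k / \<mu> * e k \<omega> + a k \<omega> * (u k \<omega> + e k \<omega>) + b k \<omega> - c k * d k \<omega>"
        let ?y2 = "(1 - \<kappa> * \<gamma> k) * e k \<omega> + a k \<omega> * (u k \<omega> + e k \<omega>) + b k \<omega>"
        have y1: "nn_cond_exp M (\<F> k) (\<lambda>w. ennreal (u (Suc k) w)) \<omega> \<le> ennreal ?y1" "0 \<le> ?y1"
          using elim(1) by (auto dest!: spec[of _ k] enn2ereal_le_erealD)
        have y2: "nn_cond_exp M (\<F> k) (\<lambda>w. ennreal (e (Suc k) w)) \<omega> \<le> ennreal ?y2" "0 \<le> ?y2"
          using elim(2) by (auto dest!: spec[of _ k] enn2ereal_le_erealD)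
        have cd: "0 \<le> c k * d k \<omega>"
          using c d by simp
        have "nn_cond_exp M (\<F> k) (\<lambda>w. ennreal (V (Suc k) w)) \<omega> + ennreal (c k * d k \<omega>)
            \<le> ennreal ?y1 + ennreal p * ennreal ?y2 + ennreal (c k * d k \<omega>)"
          using elim(3) y1(1) y2(1) by (auto intro!: add_mono mult_left_mono)
        also have "\<dots> = ennreal (?y1 + p * ?y2 + c k * d k \<omega>)"
          using y1(2) y2(2) p cd by (simp only: ennreal_plus ennreal_mult add_nonneg_nonneg mult_nonneg_nonneg less_imp_le)
        also have "\<dots> \<le> ennreal (V k \<omega> + s k \<omega> * (1 + V k \<omega>))"
        proof (rule ennreal_leI)
          have "?y1 + p * ?y2 + c k * d k \<omega> = V k \<omega> + (1 + p) * (a k \<omega> * (u k \<omega> + e k \<omega>) + b k \<omega>)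
              + (\<gamma> k / \<mu> - p * (\<kappa> * \<gamma> k)) * e k \<omega>"
            by (simp add: V_def algebra_simps)
          \<comment> \<open>By the choice of \<open>p\<close>, the decay of \<open>e\<close> in the
            second row exactly pays for its contribution to the first.\<close>
          also have "\<dots> = V k \<omega> + (1 + p) * (a k \<omega> * (u k \<omega> + e k \<omega>) + b k \<omega>)"
            by (simp add: p\<gamma>)
          also have "\<dots> \<le> V k \<omega> + (1 + p) * (a k \<omega> * (C * V k \<omega>) + b k \<omega>)"
            using elim(4) ue_le p by (intro add_left_mono mult_left_mono add_right_mono) auto
          also have "\<dots> \<le> V k \<omega> + (1 + p) * ((C * a k \<omega> + b k \<omega>) * (1 + V k \<omega>))"
            using elim(4,5) V_nonneg[of k \<omega>] C p
            by (intro add_left_mono mult_left_mono) (auto simp: algebra_simps)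
          also have "\<dots> = V k \<omega> + s k \<omega> * (1 + V k \<omega>)"
            by (simp add: s_def mult.assoc)
          finally show "?y1 + p * ?y2 + c k * d k \<omega> \<le> V k \<omega> + s k \<omega> * (1 + V k \<omega>)" .
        qed
        finally show "nn_cond_exp M (\<F> k) (\<lambda>w. ennreal (V (Suc k) w)) \<omega> + ennreal (c k * d k \<omega>)
          \<le> ennreal (V k \<omega> + s k \<omega> * (1 + V k \<omega>))" .
      qed
    qed
  qed (use V_nonneg in auto)
  \<comment> \<open>Now that \<open>V\<close> is known to converge, it is bounded, and so is
    \<open>u + e\<close>. The coupling and noise in the second row thus form a summable additive
    perturbation of \<open>e\<close> alone.\<close>
  define t where "t k \<omega> = a k \<omega> * (u k \<omega> + e k \<omega>) + b k \<omega>" for k \<omega>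
  have "AE \<omega> in M. convergent (\<lambda>k. e k \<omega>) \<and> summable (\<lambda>k. \<kappa> * \<gamma> k * e k \<omega>)"
  proof (rule almost_supermartingale_convergent[where s = t])
    show "(\<lambda>\<omega>. \<kappa> * \<gamma> k * e k \<omega>) \<in> borel_measurable (\<F> k)" for k
      using e by (intro borel_measurable_times borel_measurable_const)
    show "0 \<le> \<kappa> * \<gamma> k * e k \<omega>" for k \<omega>
      using pos \<gamma> e by simp
    show "AE \<omega> in M. \<forall>k. 0 \<le> t k \<omega>"
      using a(1) b(1) by eventually_elim (use u e in \<open>auto simp: t_def\<close>)
    show "AE \<omega> in M. summable (\<lambda>k. t k \<omega>)"
      using a b V_conv
    proof eventually_elim
      case (elim \<omega>)
      then have "Bseq (\<lambda>k. V k \<omega>)"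
        by (intro convergent_imp_Bseq) auto
      then obtain K where K: "\<And>k. \<bar>V k \<omega>\<bar> \<le> K"
        by (auto simp: Bseq_def)
      have "summable (\<lambda>k. a k \<omega> * (u k \<omega> + e k \<omega>))"
      proof (rule summable_comparison_test'[where N = 0])
        show "summable (\<lambda>k. a k \<omega> * (C * K))"
          using elim by (intro summable_mult2) auto
        show "norm (a k \<omega> * (u k \<omega> + e k \<omega>)) \<le> a k \<omega> * (C * K)" for k
        proof -
          have "u k \<omega> + e k \<omega> \<le> C * K"
            using ue_le[of k \<omega>] K[of k] C by (meson abs_le_D1 mult_left_mono less_imp_le order_trans)
          then show ?thesis
            using elim(1) u e by (simp add: abs_mult mult_left_mono)
        qed
      qed
      then show ?case
        unfolding t_def using elim by (intro summable_add) auto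
    qed
    show "AE \<omega> in M. \<forall>k. nn_cond_exp M (\<F> k) (\<lambda>w. ennreal (e (Suc k) w)) \<omega> + ennreal (\<kappa> * \<gamma> k * e k \<omega>)
        \<le> ennreal (e k \<omega> + t k \<omega> * (1 + e k \<omega>))"
      using e_step a(1) b(1)
    proof eventually_elim
      case (elim \<omega>)
      show ?case
      proof
        fix k
        let ?y = "(1 - \<kappa> * \<gamma> k) * e k \<omega> + t k \<omega>"
        have y: "nn_cond_exp M (\<F> k) (\<lambda>w. ennreal (e (Suc k) w)) \<omega> \<le> ennreal ?y" "0 \<le> ?y"
          using elim(1) by (auto simp: t_def add.assoc dest!: spec[of _ k] enn2ereal_le_erealD)
        have "0 \<le> t k \<omega> * e k \<omega>"
          using elim u e by (simp add: t_def)
        then have "?y + \<kappa> * \<gamma> k * e k \<omega> \<le> e k \<omega> + t k \<omega> * (1 + e k \<omega>)"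
          by (simp add: algebra_simps)
        moreover have "nn_cond_exp M (\<F> k) (\<lambda>w. ennreal (e (Suc k) w)) \<omega> + ennreal (\<kappa> * \<gamma> k * e k \<omega>)
            \<le> ennreal (?y + \<kappa> * \<gamma> k * e k \<omega>)"
          using y pos \<gamma> e by (subst ennreal_plus) (auto intro: add_right_mono)
        ultimately show "nn_cond_exp M (\<F> k) (\<lambda>w. ennreal (e (Suc k) w)) \<omega> + ennreal (\<kappa> * \<gamma> k * e k \<omega>)
            \<le> ennreal (e k \<omega> + t k \<omega> * (1 + e k \<omega>))"
          by (meson ennreal_leI order_trans)
      qed
    qed
  qed (use e in auto)
  with V_conv show ?thesis
  proof eventually_elim
    case (elim \<omega>)
    then obtain l where l: "(\<lambda>k. e k \<omega>) \<longlonglongrightarrow> l"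
      by (auto simp: convergent_def)
    have "summable (\<lambda>k. \<gamma> k * e k \<omega>)"
      using summable_mult[of "\<lambda>k. \<kappa> * \<gamma> k * e k \<omega>" "1 / \<kappa>"] elim pos by simp
    note freq = frequently_less_if_summable_weighted[OF \<gamma> this]
    have "0 \<le> l"
      using l e by (intro LIMSEQ_le_const) auto
    \<comment> \<open>Since \<open>\<gamma> * e\<close> is summable and \<open>\<gamma>\<close> is
      not, \<open>e\<close> falls below every positive level infinitely often.\<close>
    moreover have "\<not> 0 < l"
    proof
      assume "0 < l"
      then have "\<forall>\<^sub>F k in sequentially. l / 2 < e k \<omega>"
        using l by (intro order_tendstoD) auto
      then have "\<forall>\<^sub>F k in sequentially. \<not> e k \<omega> < l / 2"
        by eventually_elim simp
      moreover have "\<exists>\<^sub>F k in sequentially. e k \<omega> < l / 2"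
        using \<open>0 < l\<close> by (intro freq) auto
      ultimately show False
        unfolding frequently_def by blast
    qed
    ultimately have e0: "(\<lambda>k. e k \<omega>) \<longlonglongrightarrow> 0"
      using l by simp
    obtain v where "(\<lambda>k. V k \<omega>) \<longlonglongrightarrow> v"
      using elim by (auto simp: convergent_def)
    then have "(\<lambda>k. V k \<omega> - p * e k \<omega>) \<longlonglongrightarrow> v - p * 0"
      by (intro tendsto_intros e0)
    then have "convergent (\<lambda>k. u k \<omega>)"
      by (auto simp: V_def convergent_def)
    with e0 elim show ?case by simp
  qed
qed

end

section \<open>From converging distances to a converging sequence\<close>

text \<open>An Opial-type argument: a cluster point lies in the sublevel set by continuity, and
  converging distances to nearby points of \<open>D\<close> force the whole sequence towards
  it.\<close>

lemma tendsto_minimizer_if_distances_converge: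
  fixes y :: "nat \<Rightarrow> 'a::euclidean_space" and F :: "'a \<Rightarrow> real"
  assumes dist: "\<And>\<theta>. \<theta> \<in> D \<Longrightarrow> convergent (\<lambda>k. norm (y k - \<theta>))"
    and dense: "{\<theta>. F \<theta> \<le> v} \<subseteq> closure D" and "D \<noteq> {}"
    and cont: "continuous_on UNIV F"
    and freq: "\<And>\<epsilon>. 0 < \<epsilon> \<Longrightarrow> \<exists>\<^sub>F k in sequentially. F (y k) - v < \<epsilon>"
  obtains \<xi> where "F \<xi> \<le> v" "y \<longlonglongrightarrow> \<xi>"
proof -
  obtain \<theta>0 where "\<theta>0 \<in> D"
    using \<open>D \<noteq> {}\<close> by blast
  then have "Bseq (\<lambda>k. norm (y k - \<theta>0))"
    by (intro convergent_imp_Bseq dist)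
  then obtain K where K: "\<And>k. norm (y k - \<theta>0) \<le> K"
    by (auto simp: Bseq_def)
  \<comment> \<open>The chosen indices \<open>n j\<close> need not be strictly increasing;
    \<open>j \<le> n j\<close> is enough for \<open>n (q j)\<close> to tend to infinity.\<close>
  have "\<exists>k\<ge>j. F (y k) - v < 1 / Suc j" for j
    using freq[of "1 / Suc j"] by (auto simp: frequently_sequentially)
  then obtain n where n: "\<And>j. j \<le> n j" "\<And>j. F (y (n j)) - v < 1 / Suc j"
    by metis
  have "seq_compact (cball \<theta>0 K)"
    by (simp add: compact_imp_seq_compact)
  moreover have "\<forall>j. y (n j) \<in> cball \<theta>0 K"
    using K by (simp add: dist_norm norm_minus_commute)
  ultimately obtain \<xi> q where q: "strict_mono q" and lim: "(\<lambda>j. y (n (q j))) \<longlonglongrightarrow> \<xi>"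
    unfolding seq_compact_def comp_def by (elim allE[of _ "\<lambda>j. y (n j)"]) blast
  have nq: "filterlim (\<lambda>j. n (q j)) at_top sequentially"
    using n(1) by (intro filterlim_at_top_mono[OF filterlim_subseq[OF q]]) auto
  have "(\<lambda>j. F (y (n (q j)))) \<longlonglongrightarrow> F \<xi>"
    using cont lim by (auto intro: continuous_on_tendsto_compose)
  moreover have "(\<lambda>j. v + 1 / Suc (q j)) \<longlonglongrightarrow> v + 0"
    by (intro tendsto_intros filterlim_compose[OF LIMSEQ_Suc[OF lim_1_over_n] filterlim_subseq[OF q]])
  moreover have "F (y (n (q j))) \<le> v + 1 / Suc (q j)" for j
    using n(2)[of "q j"] by simp
  ultimately have \<xi>: "F \<xi> \<le> v"
    by (intro LIMSEQ_le) auto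
  have "y \<longlonglongrightarrow> \<xi>"
  proof (rule LIMSEQ_I)
    fix \<epsilon> :: real assume "0 < \<epsilon>"
    \<comment> \<open>The cluster point \<open>\<xi>\<close> itself may lie outside
      \<open>D\<close>, so a nearby \<open>\<theta>\<close> in \<open>D\<close> replaces it. The
      limit \<open>l\<close> of the distances to \<open>\<theta>\<close> is then identified along
      the subsequence.\<close>
    then obtain \<theta> where \<theta>: "\<theta> \<in> D" "norm (\<theta> - \<xi>) < \<epsilon> / 2"
      using \<xi> dense closure_approachable[of \<xi> D] by (auto simp: dist_norm dest!: spec[of _ "\<epsilon> / 2"])
    obtain l where l: "(\<lambda>k. norm (y k - \<theta>)) \<longlonglongrightarrow> l"
      using dist[OF \<theta>(1)] by (auto simp: convergent_def)
    have "(\<lambda>j. norm (y (n (q j)) - \<theta>)) \<longlonglongrightarrow> l"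
      using filterlim_compose[OF l nq] .
    moreover have "(\<lambda>j. norm (y (n (q j)) - \<theta>)) \<longlonglongrightarrow> norm (\<xi> - \<theta>)"
      by (intro tendsto_intros lim)
    ultimately have "l < \<epsilon> / 2"
      using \<theta>(2) by (metis LIMSEQ_unique norm_minus_commute)
    then have "\<forall>\<^sub>F k in sequentially. norm (y k - \<theta>) < \<epsilon> / 2"
      using l by (intro order_tendstoD)
    then have "\<forall>\<^sub>F k in sequentially. norm (y k - \<xi>) < \<epsilon>"
    proof eventually_elim
      case (elim k)
      then show ?case
        using \<theta>(2) norm_triangle_ineq[of "y k - \<theta>" "\<theta> - \<xi>"] by simp
    qed
    then show "\<exists>no. \<forall>k\<ge>no. norm (y k - \<xi>) < \<epsilon>"
      by (simp add: eventually_sequentially)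
  qed
  with \<xi> that show thesis by blast
qed

section \<open>The natural filtration\<close>

lemma space_history [simp]: "space (history M m x k) = space M"
  by (simp add: history_def space_measure_of_conv)

lemma sets_history:
  "sets (history M m x k) = sigma_sets (space M)
    {x i l -` B \<inter> space M | i l B. i \<in> {1..m} \<and> l \<le> k \<and> B \<in> sets borel}"
  unfolding history_def by (rule sets_measure_of) auto

lemma measurable_history:
  fixes x :: "nat \<Rightarrow> nat \<Rightarrow> 'w \<Rightarrow> 'b::topological_space"
  assumes "i \<in> {1..m}" "l \<le> k"
  shows "x i l \<in> borel_measurable (history M m x k)"
proof (rule measurableI)
  fix B :: "'b set" assume "B \<in> sets borel"
  then show "x i l -` B \<inter> space (history M m x k) \<in> sets (history M m x k)"
    unfolding sets_history space_history using assms by (intro sigma_sets.Basic) blast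
qed simp

lemma filtered_prob_space_history:
  assumes "prob_space M" and x: "\<And>i k. i \<in> {1..m} \<Longrightarrow> x i k \<in> borel_measurable M"
  shows "filtered_prob_space M (history M m x)"
proof -
  interpret prob_space M by fact
  show ?thesis
  proof
    show "subalgebra M (history M m x k)" for k
      unfolding subalgebra_def sets_history
      using x by (auto intro!: sets.sigma_sets_subset measurable_sets)
    show "sets (history M m x k) \<subseteq> sets (history M m x (Suc k))" for k
      unfolding sets_history by (intro sigma_sets_subseteq) (auto intro: le_SucI)
  qed
qed

lemma mean_iterate_measurable:
  fixes x :: "nat \<Rightarrow> nat \<Rightarrow> 'w \<Rightarrow> 'a::euclidean_space"
  shows "mean_iterate m x k \<in> borel_measurable (history M m x k)"
proof -
  have "(\<lambda>\<omega>. (1 / real m) *\<^sub>R (\<Sum>i\<in>{1..m}. x i k \<omega>)) \<in> borel_measurable (history M m x k)"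
    by (intro borel_measurable_scaleR borel_measurable_const borel_measurable_sum measurable_history) auto
  then show ?thesis
    by (simp add: mean_iterate_def[abs_def] average_def)
qed

lemma consensus_error_measurable:
  fixes x :: "nat \<Rightarrow> nat \<Rightarrow> 'w \<Rightarrow> 'a::euclidean_space"
  shows "consensus_error m x k \<in> borel_measurable (history M m x k)"
  unfolding consensus_error_def[abs_def]
proof (rule borel_measurable_sum)
  fix i assume "i \<in> {1..m}"
  then have [measurable]: "x i k \<in> borel_measurable (history M m x k)"
    by (rule measurable_history) simp
  note [measurable] = mean_iterate_measurable[of m x k M]
  show "(\<lambda>\<omega>. (norm (x i k \<omega> - mean_iterate m x k \<omega>))\<^sup>2) \<in> borel_measurable (history M m x k)"
    by measurable
qed

lemma consensus_error_nonneg: "0 \<le> consensus_error m x k \<omega>"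
  unfolding consensus_error_def by (intro sum_nonneg) auto

text \<open>Each squared deviation is one term of a sum of nonnegative terms, hence at most the
  whole sum.\<close>

lemma consensus_error_tendsto_0D:
  assumes "(\<lambda>k. consensus_error m x k \<omega>) \<longlonglongrightarrow> 0" and i: "i \<in> {1..m}"
  shows "(\<lambda>k. norm (x i k \<omega> - mean_iterate m x k \<omega>)) \<longlonglongrightarrow> 0"
proof -
  have le: "norm (x i k \<omega> - mean_iterate m x k \<omega>) \<le> sqrt (consensus_error m x k \<omega>)" for k
    unfolding consensus_error_def using i
    by (intro real_le_rsqrt member_le_sum[where f = "\<lambda>i. (norm (x i k \<omega> - mean_iterate m x k \<omega>))\<^sup>2"]) auto
  have "(\<lambda>k. sqrt (consensus_error m x k \<omega>)) \<longlonglongrightarrow> 0"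
    using tendsto_real_sqrt[OF assms(1)] by simp
  then show ?thesis
    by (rule Lim_null_comparison[rotated]) (simp add: le)
qed

section \<open>Minimizers, the recursion in coordinates, and the final assembly\<close>

lemma solutions_eq_sublevel:
  assumes "\<theta> \<in> solutions F"
  shows "solutions F = {\<xi>. F \<xi> \<le> F \<theta>}"
  using assms by (auto simp: solutions_def is_arg_min_linorder) (meson order_trans)

text \<open>Reads off the two rows of the recursion, so that the vector inequality becomes the two
  scalar premises of \<open>coupled_recursion_convergent\<close>.\<close>

lemma perturbed_triangular_mult_vector:
  fixes \<alpha> g h u e :: real
  defines "w \<equiv> ((vector [vector [1, g], vector [0, h]] :: real ^ 2 ^ 2) + \<alpha> *\<^sub>R (\<chi> p q. 1)) *v vector [u, e]"
  shows "w $ 1 = u + g * e + \<alpha> * (u + e)" and "w $ 2 = h * e + \<alpha> * (u + e)"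
  by (simp_all add: w_def matrix_vector_mult_def sum_2 algebra_simps)

text \<open>The exceptional null set of the recursion may depend on the solution
  \<open>\<theta>\<close>. Divergence of the series is stated in \<open>ennreal\<close>, where an
  infinite sum has a genuine value. The limit \<open>\<theta>t\<close> is required to be a random
  variable with values in the solution set.\<close>

theorem lemma6:
  fixes M :: "'w measure"
    and m :: nat
    and f :: "nat \<Rightarrow> real ^ 'd \<Rightarrow> real"
    and grad :: "nat \<Rightarrow> real ^ 'd \<Rightarrow> real ^ 'd"
    and L \<kappa> :: real
    and x :: "nat \<Rightarrow> nat \<Rightarrow> 'w \<Rightarrow> real ^ 'd"
    and a b :: "nat \<Rightarrow> 'w \<Rightarrow> real"
    and c \<gamma> :: "nat \<Rightarrow> real"
  defines "F \<equiv> objective m f"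
    and "xbar \<equiv> mean_iterate m x"
    and "\<F> \<equiv> history M m x"
  assumes "prob_space M"
    and "m \<ge> 1"
    and "convex_on UNIV F"
    and "\<And>i u. i \<in> {1..m} \<Longrightarrow> GDERIV (f i) u :> grad i u"
    and "L > 0"
    and "\<And>i u v. i \<in> {1..m} \<Longrightarrow> norm (grad i u - grad i v) \<le> L * norm (u - v)"
    and "solutions F \<noteq> {}"
    and "\<And>i k. i \<in> {1..m} \<Longrightarrow> x i k \<in> borel_measurable M"
    and "\<And>k. a k \<in> borel_measurable M"
    and "\<And>k. b k \<in> borel_measurable M"
    and "AE \<omega> in M. \<forall>k. 0 \<le> a k \<omega>"
    and "AE \<omega> in M. \<forall>k. 0 \<le> b k \<omega>"
    and "AE \<omega> in M. summable (\<lambda>k. a k \<omega>)"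
    and "AE \<omega> in M. summable (\<lambda>k. b k \<omega>)"
    and "\<And>k. 0 \<le> c k"
    and "\<And>k. 0 \<le> \<gamma> k"
    and "(\<Sum>k. ennreal (c k)) = \<infinity>"
    and "(\<Sum>k. ennreal (\<gamma> k)) = \<infinity>"
    and "\<kappa> > 0"
    and "\<And>k. \<kappa> * \<gamma> k < 1"
    and "\<And>\<theta>. \<theta> \<in> solutions F \<Longrightarrow>
      AE \<omega> in M. \<forall>k.
        (vector
          [nonneg_cond_exp M (\<F> k) (\<lambda>w. (norm (xbar (Suc k) w - \<theta>))\<^sup>2) \<omega>,
           nonneg_cond_exp M (\<F> k) (consensus_error m x (Suc k)) \<omega>] :: ereal ^ 2)
        \<le> (\<chi> j. ereal
            ((((vector [vector [1, \<gamma> k / real m],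
                        vector [0, 1 - \<kappa> * \<gamma> k]] :: real ^ 2 ^ 2)
                + a k \<omega> *\<^sub>R (\<chi> p q. 1))
                *v vector [(norm (xbar k \<omega> - \<theta>))\<^sup>2, consensus_error m x k \<omega>]
              + b k \<omega> *\<^sub>R (1 :: real ^ 2)
              - c k *\<^sub>R vector [F (xbar k \<omega>) - F \<theta>, 0]) $ j))"
  shows "(\<forall>i\<in>{1..m}. AE \<omega> in M. (\<lambda>k. norm (x i k \<omega> - xbar k \<omega>)) \<longlonglongrightarrow> 0) \<and>
    (\<exists>\<theta>t. \<theta>t \<in> borel_measurable M \<and> (\<forall>\<omega>\<in>space M. \<theta>t \<omega> \<in> solutions F) \<and>
      (AE \<omega> in M. (\<lambda>k. norm (xbar k \<omega> - \<theta>t \<omega>)) \<longlonglongrightarrow> 0))"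
proof -
  note prob = assms(4) and m = assms(5) and sol = assms(10) and x = assms(11)
    and ab = assms(14-17) and c = assms(18) and \<gamma> = assms(19) and \<kappa> = assms(22)
    and recursion = assms(24)
  have c_div: "\<not> summable c" and \<gamma>_div: "\<not> summable \<gamma>"
    using not_summable_if_suminf_ennreal_infinite[OF c assms(20)]
      not_summable_if_suminf_ennreal_infinite[OF \<gamma> assms(21)] by simp_all
  interpret filtered_prob_space M \<F>
    unfolding \<F>_def using prob x by (rule filtered_prob_space_history)
  \<comment> \<open>A real-valued convex function on a finite-dimensional space is
    continuous.\<close>
  have cont: "continuous_on UNIV F"
    using assms(6) by (intro convex_on_continuous) auto
  then have F_borel: "F \<in> borel_measurable borel"
    by (rule borel_measurable_continuous_onI)
  have xbar: "xbar k \<in> borel_measurable (\<F> k)" for k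
    unfolding xbar_def \<F>_def by (rule mean_iterate_measurable)
  have main: "AE \<omega> in M. convergent (\<lambda>k. (norm (xbar k \<omega> - \<theta>))\<^sup>2) \<and>
      (\<lambda>k. consensus_error m x k \<omega>) \<longlonglongrightarrow> 0 \<and> summable (\<lambda>k. c k * (F (xbar k \<omega>) - F \<theta>))"
    if \<theta>: "\<theta> \<in> solutions F" for \<theta>
  proof (rule coupled_recursion_convergent[where \<gamma> = \<gamma> and \<mu> = "real m" and \<kappa> = \<kappa> and a = a and b = b])
    show "(\<lambda>\<omega>. (norm (xbar k \<omega> - \<theta>))\<^sup>2) \<in> borel_measurable (\<F> k)" for k
      using xbar[of k] by measurable
    show "consensus_error m x k \<in> borel_measurable (\<F> k)" for k
      unfolding \<F>_def by (rule consensus_error_measurable)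
    show "(\<lambda>\<omega>. F (xbar k \<omega>) - F \<theta>) \<in> borel_measurable (\<F> k)" for k
      by (intro borel_measurable_diff borel_measurable_const measurable_compose[OF xbar F_borel])
    show "0 \<le> F (xbar k \<omega>) - F \<theta>" for k \<omega>
      using \<theta> by (simp add: solutions_def is_arg_min_linorder)
    show "AE \<omega> in M. \<forall>k. enn2ereal (nn_cond_exp M (\<F> k) (\<lambda>w. ennreal ((norm (xbar (Suc k) w - \<theta>))\<^sup>2)) \<omega>)
      \<le> ereal ((norm (xbar k \<omega> - \<theta>))\<^sup>2 + \<gamma> k / real m * consensus_error m x k \<omega>
          + a k \<omega> * ((norm (xbar k \<omega> - \<theta>))\<^sup>2 + consensus_error m x k \<omega>) + b k \<omega>
          - c k * (F (xbar k \<omega>) - F \<theta>))"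
      using recursion[OF \<theta>]
      by eventually_elim (auto simp: less_eq_vec_def forall_2 perturbed_triangular_mult_vector nonneg_cond_exp_def)
    show "AE \<omega> in M. \<forall>k. enn2ereal (nn_cond_exp M (\<F> k) (\<lambda>w. ennreal (consensus_error m x (Suc k) w)) \<omega>)
      \<le> ereal ((1 - \<kappa> * \<gamma> k) * consensus_error m x k \<omega>
          + a k \<omega> * ((norm (xbar k \<omega> - \<theta>))\<^sup>2 + consensus_error m x k \<omega>) + b k \<omega>)"
      using recursion[OF \<theta>]
      by eventually_elim (auto simp: less_eq_vec_def forall_2 perturbed_triangular_mult_vector nonneg_cond_exp_def)
  qed (use ab c \<gamma> \<gamma>_div \<kappa> m consensus_error_nonneg in auto)
  obtain \<theta>0 where \<theta>0: "\<theta>0 \<in> solutions F"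
    using sol by blast
  note sub = solutions_eq_sublevel[OF \<theta>0]
  \<comment> \<open>\<open>main\<close> has a null set for each solution. Restricting to a countable
    dense set of solutions leaves a single one.\<close>
  obtain D where D: "countable D" "D \<subseteq> solutions F" "solutions F \<subseteq> closure D"
    by (rule separable)
  have "D \<noteq> {}"
    using D(3) sol by auto
  have "AE \<omega> in M. \<forall>\<theta>\<in>D. convergent (\<lambda>k. (norm (xbar k \<omega> - \<theta>))\<^sup>2)"
    using D main by (subst AE_ball_countable) (auto elim!: eventually_mono)
  with main[OF \<theta>0] have conv: "AE \<omega> in M. \<exists>\<xi>\<in>solutions F. (\<lambda>k. xbar k \<omega>) \<longlonglongrightarrow> \<xi>"
  proof eventually_elim
    case (elim \<omega>)
    have "convergent (\<lambda>k. norm (xbar k \<omega> - \<theta>))" if "\<theta> \<in> D" for \<theta>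
    proof -
      obtain l where "(\<lambda>k. (norm (xbar k \<omega> - \<theta>))\<^sup>2) \<longlonglongrightarrow> l"
        using elim(2) \<open>\<theta> \<in> D\<close> by (auto simp: convergent_def)
      from tendsto_real_sqrt[OF this] show ?thesis
        by (auto simp: convergent_def)
    qed
    moreover have "\<exists>\<^sub>F k in sequentially. F (xbar k \<omega>) - F \<theta>0 < \<epsilon>" if "0 < \<epsilon>" for \<epsilon>
      using elim(1) c c_div that by (intro frequently_less_if_summable_weighted[of c]) auto
    ultimately obtain \<xi> where "F \<xi> \<le> F \<theta>0" "(\<lambda>k. xbar k \<omega>) \<longlonglongrightarrow> \<xi>"
      using D(3) \<open>D \<noteq> {}\<close> cont unfolding sub
      by (elim tendsto_minimizer_if_distances_converge[rotated -1])
    then show ?case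
      by (auto simp: sub)
  qed
  \<comment> \<open>\<open>lim\<close> is unspecified for a divergent sequence; the default
    \<open>\<theta>0\<close> makes \<open>\<theta>t\<close> a solution at every outcome, and it is
    used only on a null set.\<close>
  define \<theta>t where "\<theta>t \<omega> = (if lim (\<lambda>k. xbar k \<omega>) \<in> solutions F then lim (\<lambda>k. xbar k \<omega>) else \<theta>0)" for \<omega>
  have [measurable]: "xbar k \<in> borel_measurable M" for k
    using xbar by (rule measurable_ambient)
  have [measurable]: "(\<lambda>\<omega>. lim (\<lambda>k. xbar k \<omega>)) \<in> borel_measurable M"
    by (rule borel_measurable_lim_metric) measurable
  \<comment> \<open>Closedness makes the solution set Borel, so the case distinction in
    \<open>\<theta>t\<close> is measurable.\<close>
  have "closed (solutions F)"
    unfolding sub using cont by (intro closed_Collect_le) auto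
  then have [measurable]: "solutions F \<in> sets borel"
    by (rule borel_closed)
  have "\<theta>t \<in> borel_measurable M"
    unfolding \<theta>t_def by measurable
  moreover have "\<forall>\<omega>\<in>space M. \<theta>t \<omega> \<in> solutions F"
    using \<theta>0 by (simp add: \<theta>t_def)
  moreover have "AE \<omega> in M. (\<lambda>k. norm (xbar k \<omega> - \<theta>t \<omega>)) \<longlonglongrightarrow> 0"
    using conv
  proof eventually_elim
    case (elim \<omega>)
    then obtain \<xi> where "\<xi> \<in> solutions F" "(\<lambda>k. xbar k \<omega>) \<longlonglongrightarrow> \<xi>"
      by blast
    then show ?case
      by (simp add: \<theta>t_def limI tendsto_norm_zero_iff LIM_zero_iff)
  qed
  moreover have "AE \<omega> in M. (\<lambda>k. norm (x i k \<omega> - xbar k \<omega>)) \<longlonglongrightarrow> 0" if "i \<in> {1..m}" for i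
    using main[OF \<theta>0] unfolding xbar_def
    by eventually_elim (use that in \<open>auto intro: consensus_error_tendsto_0D\<close>)
  ultimately show ?thesis
    by blast
qed

end
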